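(* Let $0\le c<1$ and let $(p_n)_{n\ge1}$ be a sequence in $[0,1]$ with $p_n=\Omega(n^{-c})$, and for each $n$ let $G_n$ be a random graph drawn from the Erdős–Rényi distribution $G(n,p_n)$. Then for all $\epsilon>0$ and $\delta>0$ there exists $N$ such that for all $n\ge N$, $$P[\mathrm{GAPVB}(G_n)<1+\delta]>1-\epsilon.$$
   Context: $p_n=\Omega(n^{-c})$ means there exist $k>0$ and $n_0$ with $p_n \ge k n^{-c}$ for all $n\ge n_0$. The distribution $G(n,p)$ on graphs with vertex set of size $n$ includes each of the $\binom{n}{2}$ possible edges independently with probability $p$. For an undirected graph $G=(V,E)$ with $|V|=n$, a layout is a bijection $\phi:V\to\{1,\dots,n\}$. For $1\le i\le n$, let $\sigma(i,\phi,G)$ be the number of vertices $u$ with $\phi(u)\le i$ for which there exists $v$ with $\phi(v)>i$ and $uv\in E$. Define $\mathrm{VB}(G,\phi)=\sigma(\lfloor n/2\rfloor,\phi,G)$, $\mathrm{MINVB}(G)=\min_\phi\mathrm{VB}(G,\phi)$, $\mathrm{MAXVB}(G)=\max_\phi\mathrm{VB}(G,\phi)$ over all layouts $\phi$, and $\mathrm{GAPVB}(G)=\mathrm{MAXVB}(G)/\mathrm{MINVB}(G)$. *)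

theory Defs
  imports "HOL-Probability.Probability" "HOL-Probability.Product_PMF"
begin

text \<open>A simple graph is given by a vertex set \<open>V\<close> and a set \<open>E\<close> of two-element subsets of \<open>V\<close>.\<close>

definition all_edges :: "'a set \<Rightarrow> 'a set set" where
  "all_edges V = {e. e \<subseteq> V \<and> card e = 2}"

definition erdos_renyi :: "nat \<Rightarrow> real \<Rightarrow> nat set set pmf" where
  "erdos_renyi n p =
     map_pmf (\<lambda>f. {e \<in> all_edges {1..n}. f e})
       (Pi_pmf (all_edges {1..n}) False (\<lambda>_. bernoulli_pmf p))"

definition layouts :: "'a set \<Rightarrow> ('a \<Rightarrow> nat) set" where
  "layouts V = {\<phi>. bij_betw \<phi> V {1..card V}}"

definition layout_sigma :: "nat \<Rightarrow> ('a \<Rightarrow> nat) \<Rightarrow> 'a set \<Rightarrow> 'a set set \<Rightarrow> nat" where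
  "layout_sigma i \<phi> V E = card {u \<in> V. \<phi> u \<le> i \<and> (\<exists>v\<in>V. \<phi> v > i \<and> {u, v} \<in> E)}"

definition VB :: "'a set \<Rightarrow> 'a set set \<Rightarrow> ('a \<Rightarrow> nat) \<Rightarrow> nat" where
  "VB V E \<phi> = layout_sigma (card V div 2) \<phi> V E"

text \<open>
  Layouts are unconstrained outside \<open>V\<close>, so \<open>layouts V\<close> may be infinite; the following two
  facts show that \<open>Min\<close> and \<open>Max\<close> below are nevertheless taken over a finite nonempty set.
\<close>

lemma finite_VB_layouts:
  assumes "finite V"
  shows "finite (VB V E ` layouts V)"
proof -
  have "VB V E \<phi> \<le> card V" for \<phi>
    unfolding VB_def layout_sigma_def by (rule card_mono) (use assms in auto)
  then have "VB V E ` layouts V \<subseteq> {..card V}"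
    by auto
  then show ?thesis
    by (rule finite_subset) simp
qed

lemma layouts_nonempty:
  assumes "finite V"
  shows "layouts V \<noteq> {}"
  using finite_same_card_bij[OF assms, of "{1..card V}"] by (auto simp: layouts_def)

definition MINVB :: "'a set \<Rightarrow> 'a set set \<Rightarrow> nat" where
  "MINVB V E = Min (VB V E ` layouts V)"

definition MAXVB :: "'a set \<Rightarrow> 'a set set \<Rightarrow> nat" where
  "MAXVB V E = Max (VB V E ` layouts V)"

text \<open>
  The quotient is extended-real valued, with value \<open>\<infinity>\<close> when the denominator vanishes
  (including \<open>0/0\<close>): with the library convention \<open>x / 0 = 0\<close> an upper bound on the gap would
  hold vacuously for graphs whose quotient is undefined.
\<close>

definition GAPVB :: "'a set \<Rightarrow> 'a set set \<Rightarrow> ereal" where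
  "GAPVB V E =
     (if MINVB V E = 0 then \<infinity> else ereal (real (MAXVB V E) / real (MINVB V E)))"

end

theory Submission
  imports Defs "HOL-Real_Asymp.Real_Asymp"
begin

text \<open>
  Every layout has \<open>VB \<le> \<lfloor>n/2\<rfloor>\<close>, and \<open>VB\<close> falls short of \<open>\<lfloor>n/2\<rfloor>\<close> exactly by the number of
  vertices in the left half without a neighbour in the right half. If no set of at least
  \<open>\<gamma> n\<close> vertices is non-adjacent to a disjoint set of at least \<open>n/2\<close> vertices, this number
  is below \<open>\<gamma> n\<close> for every layout, so all values of \<open>VB\<close> are close to \<open>\<lfloor>n/2\<rfloor>\<close>. A union bound over
  at most \<open>4^n\<close> pairs of sets, each non-adjacent with probability at most
  \<open>exp (- p \<gamma> n\<^sup>2 / 2)\<close>, shows that this fails with vanishing probability as \<open>p n \<rightarrow> \<infinity>\<close>.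
\<close>

section \<open>Edges between two disjoint vertex sets\<close>

definition cross_edges :: "'a set \<Rightarrow> 'a set \<Rightarrow> 'a set set" where
  "cross_edges A B = (\<lambda>(a, b). {a, b}) ` (A \<times> B)"

text \<open>Sizes are compared as reals, so no rounding of \<open>n / 2\<close> intervenes: the
  right half of a layout qualifies as \<open>B\<close> for odd \<open>n\<close> too.\<close>

definition large_disjoint_pairs :: "real \<Rightarrow> nat \<Rightarrow> (nat set \<times> nat set) set" where
  "large_disjoint_pairs \<gamma> n = {(A, B). A \<subseteq> {1..n} \<and> B \<subseteq> {1..n} \<and> A \<inter> B = {} \<and>
     \<gamma> * real n \<le> real (card A) \<and> real n / 2 \<le> real (card B)}"

text \<open>Disjointness makes the unordered pair \<open>{a, b}\<close> determine which endpoint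
  lies in \<open>A\<close>, so distinct ordered pairs give distinct edges.\<close>

lemma card_cross_edges:
  assumes "A \<inter> B = {}"
  shows "card (cross_edges A B) = card A * card B"
proof -
  have "inj_on (\<lambda>(a, b). {a, b}) (A \<times> B)"
    using assms by (auto simp: inj_on_def doubleton_eq_iff)
  then show ?thesis
    by (simp add: cross_edges_def card_image card_cartesian_product)
qed

lemma cross_edges_subset:
  assumes "A \<subseteq> V" "B \<subseteq> V" "A \<inter> B = {}"
  shows "cross_edges A B \<subseteq> all_edges V"
  using assms by (fastforce simp: cross_edges_def all_edges_def card_insert_if)

lemma finite_all_edges: "finite V \<Longrightarrow> finite (all_edges V)"
  by (rule finite_subset[of _ "Pow V"]) (auto simp: all_edges_def)

lemma prob_erdos_renyi_avoids:
  assumes "0 \<le> p" "p \<le> 1" "S \<subseteq> all_edges {1..n}"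
  shows "measure_pmf.prob (erdos_renyi n p) {E. E \<inter> S = {}} = (1 - p) ^ card S"
proof -
  define U where "U = all_edges {1..n}"
  have fin: "finite U" and S: "S \<subseteq> U"
    using assms by (auto simp: U_def finite_all_edges)
  \<comment> \<open>In terms of the edge indicators the event is a product set: coordinates in
    \<open>S\<close> are forced to \<open>False\<close>, all others are free. Independence then
    turns its probability into a product.\<close>
  have "(\<lambda>f. {e \<in> U. f e}) -` {E. E \<inter> S = {}} = Pi U (\<lambda>e. if e \<in> S then {False} else UNIV)"
    using S by (auto simp: Pi_def split: if_splits)
  then have "measure_pmf.prob (erdos_renyi n p) {E. E \<inter> S = {}} =
      (\<Prod>e\<in>U. measure_pmf.prob (bernoulli_pmf p) (if e \<in> S then {False} else UNIV))"
    unfolding erdos_renyi_def U_def[symmetric] measure_map_pmf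
    by (simp add: measure_Pi_pmf_Pi fin)
  also have "\<dots> = (\<Prod>e\<in>U. if e \<in> S then 1 - p else 1)"
    using assms by (intro prod.cong) (auto simp: measure_pmf_single)
  also have "\<dots> = (1 - p) ^ card S"
    using fin S by (simp add: prod.If_cases Int_absorb1)
  finally show ?thesis .
qed

section \<open>Deterministic bounds on \<open>VB\<close> and the gap\<close>

lemma VB_le_half:
  assumes "finite V" "\<phi> \<in> layouts V"
  shows "VB V E \<phi> \<le> card V div 2"
proof -
  have bij: "bij_betw \<phi> V {1..card V}"
    using assms by (simp add: layouts_def)
  have "VB V E \<phi> \<le> card {1..card V div 2}"
    unfolding VB_def layout_sigma_def
    by (rule card_inj_on_le[where f = \<phi>])
       (use bij in \<open>auto simp: bij_betw_def inj_on_def\<close>)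
  then show ?thesis by simp
qed

lemma card_layout_preimage:
  assumes "\<phi> \<in> layouts V" "X \<subseteq> {1..card V}"
  shows "card {u \<in> V. \<phi> u \<in> X} = card X"
proof -
  have bij: "bij_betw \<phi> V {1..card V}"
    using assms by (simp add: layouts_def)
  have "\<phi> ` {u \<in> V. \<phi> u \<in> X} = X"
    using bij assms(2) by (auto simp: bij_betw_def image_iff)
  moreover have "inj_on \<phi> {u \<in> V. \<phi> u \<in> X}"
    using bij by (auto simp: bij_betw_def inj_on_def)
  ultimately show ?thesis
    by (metis card_image)
qed

lemma VB_gt:
  assumes \<phi>: "\<phi> \<in> layouts {1..n}"
    and good: "\<And>A B. (A, B) \<in> large_disjoint_pairs \<gamma> n \<Longrightarrow> E \<inter> cross_edges A B \<noteq> {}"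
  shows "real (n div 2) - \<gamma> * real n < real (VB {1..n} E \<phi>)"
proof -
  let ?V = "{1..n}"
  define h where "h = n div 2"
  define L where "L = {u \<in> ?V. \<phi> u \<in> {1..h}}"
  define B where "B = {u \<in> ?V. \<phi> u \<in> {Suc h..n}}"
  define C where "C = {u \<in> ?V. \<phi> u \<le> h \<and> (\<exists>v\<in>?V. \<phi> v > h \<and> {u, v} \<in> E)}"
  have range: "\<phi> u \<in> {1..n}" if "u \<in> ?V" for u
    using \<phi> that by (auto simp: layouts_def bij_betw_def)
  have "h \<le> n" by (simp add: h_def)
  have cL: "card L = h" and cB: "card B = n - h"
    unfolding L_def B_def using \<open>h \<le> n\<close> by (subst card_layout_preimage[OF \<phi>]; simp)+
  have CL: "C \<subseteq> L"
    using range by (auto simp: C_def L_def)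
  have finL: "finite L" by (simp add: L_def)
  have VB: "VB ?V E \<phi> = card C"
    by (simp add: VB_def layout_sigma_def C_def h_def)
  have "{a, b} \<notin> E" if "a \<in> L - C" "b \<in> B" for a b
  proof
    assume "{a, b} \<in> E"
    moreover have "b \<in> ?V" "\<phi> b > h" "a \<in> ?V" "\<phi> a \<le> h"
      using that by (auto simp: L_def B_def)
    ultimately have "a \<in> C"
      unfolding C_def by blast
    then show False
      using that by blast
  qed
  then have no_edge: "E \<inter> cross_edges (L - C) B = {}"
    by (auto simp: cross_edges_def)
  \<comment> \<open>All other conditions on the pair are verified next, so the one that fails must
    be the lower bound on the size of \<open>L - C\<close>.\<close>
  have "(L - C, B) \<notin> large_disjoint_pairs \<gamma> n"
    using good[of "L - C" B] no_edge by blast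
  moreover have "real n / 2 \<le> real (card B)"
    unfolding cB h_def by linarith
  moreover have "L - C \<subseteq> ?V" "B \<subseteq> ?V" "(L - C) \<inter> B = {}"
    by (auto simp: L_def B_def)
  ultimately have "real (card (L - C)) < \<gamma> * real n"
    by (auto simp: large_disjoint_pairs_def)
  moreover have "card (L - C) = h - card C"
    using CL finL cL by (simp add: card_Diff_subset finite_subset)
  moreover have "card C \<le> h"
    using card_mono[OF finL CL] cL by simp
  ultimately show ?thesis
    unfolding VB by (simp add: h_def of_nat_diff)
qed

text \<open>For \<open>n \<ge> 3\<close> the half \<open>h = n div 2\<close> is at least
  \<open>n / 3\<close>, whence the 3 in the density: the loss is at most
  \<open>\<delta> / (1 + \<delta>) * h\<close>. So the minimum exceeds
  \<open>h / (1 + \<delta>)\<close>, while the maximum is at most \<open>h\<close>.\<close>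

lemma GAPVB_less:
  assumes \<delta>: "\<delta> > 0" and n: "n \<ge> 3"
    and good: "\<And>A B. (A, B) \<in> large_disjoint_pairs (\<delta> / (3 * (1 + \<delta>))) n \<Longrightarrow> E \<inter> cross_edges A B \<noteq> {}"
  shows "GAPVB {1..n} E < ereal (1 + \<delta>)"
proof -
  let ?V = "{1..n}"
  define h where "h = real (n div 2)"
  have h: "real n / 3 \<le> h" "h > 0"
    using n unfolding h_def by linarith+
  have fin: "finite (VB ?V E ` layouts ?V)" and ne: "VB ?V E ` layouts ?V \<noteq> {}"
    using layouts_nonempty[of ?V] by (auto intro: finite_VB_layouts)
  obtain \<phi> where \<phi>: "\<phi> \<in> layouts ?V" "MINVB ?V E = VB ?V E \<phi>"
    using Min_in[OF fin ne] by (auto simp: MINVB_def)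
  have "MAXVB ?V E \<le> n div 2"
    unfolding MAXVB_def using fin ne VB_le_half[of ?V _ E] by (subst Max_le_iff) auto
  then have max: "real (MAXVB ?V E) \<le> h"
    by (simp add: h_def)
  have "\<delta> / (3 * (1 + \<delta>)) * real n = \<delta> / (1 + \<delta>) * (real n / 3)"
    by simp
  also have "\<dots> \<le> \<delta> / (1 + \<delta>) * h"
    using h \<delta> by (intro mult_left_mono) auto
  finally have "h - \<delta> / (1 + \<delta>) * h < real (MINVB ?V E)"
    using VB_gt[where \<gamma> = "\<delta> / (3 * (1 + \<delta>))" and E = E, OF \<phi>(1)] good unfolding \<phi>(2) h_def by fastforce
  moreover have "h - \<delta> / (1 + \<delta>) * h = h / (1 + \<delta>)"
    using \<delta> by (simp add: field_simps)
  ultimately have min: "h / (1 + \<delta>) < real (MINVB ?V E)"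
    by simp
  moreover have "0 < h / (1 + \<delta>)"
    using h \<delta> by simp
  \<comment> \<open>This excludes the case in which \<open>GAPVB\<close> is infinite.\<close>
  ultimately have pos: "real (MINVB ?V E) > 0"
    by linarith
  have "h < (1 + \<delta>) * real (MINVB ?V E)"
    using min \<delta> by (simp add: field_simps)
  then have "real (MAXVB ?V E) / real (MINVB ?V E) < 1 + \<delta>"
    using max pos by (simp add: field_simps)
  then show ?thesis
    using pos by (simp add: GAPVB_def)
qed

section \<open>Union bound and its asymptotics\<close>

text \<open>The factor \<open>4 ^ n\<close> counts all pairs of subsets of the vertex set. The
  exponent comes from \<open>1 - p \<le> exp (- p)\<close> and from the at least
  \<open>\<gamma> * n * (n / 2)\<close> possible edges between the two sets.\<close>

lemma prob_nonadjacent_pair_le: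
  assumes p: "0 \<le> p" "p \<le> 1" and \<gamma>: "\<gamma> \<ge> 0"
  shows "measure_pmf.prob (erdos_renyi n p)
      {E. \<exists>(A, B)\<in>large_disjoint_pairs \<gamma> n. E \<inter> cross_edges A B = {}}
    \<le> 4 ^ n * exp (- (p * \<gamma> * real n ^ 2 / 2))"
proof -
  let ?M = "measure_pmf (erdos_renyi n p)"
  let ?P = "large_disjoint_pairs \<gamma> n"
  have sub: "?P \<subseteq> Pow {1..n} \<times> Pow {1..n}"
    by (auto simp: large_disjoint_pairs_def)
  have fin: "finite ?P"
    by (rule finite_subset[OF sub]) simp
  have "card ?P \<le> card (Pow {1..n} \<times> Pow {1..n})"
    by (rule card_mono[OF _ sub]) simp
  also have "\<dots> = 4 ^ n"
    by (simp add: card_cartesian_product card_Pow power_mult_distrib[symmetric])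
  finally have card: "real (card ?P) \<le> 4 ^ n"
    by (metis of_nat_le_iff of_nat_numeral of_nat_power)
  have single: "measure ?M {E. E \<inter> cross_edges A B = {}} \<le> exp (- (p * \<gamma> * real n ^ 2 / 2))"
    if AB: "(A, B) \<in> ?P" for A B
  proof -
    have *: "A \<subseteq> {1..n}" "B \<subseteq> {1..n}" "A \<inter> B = {}"
      "\<gamma> * real n \<le> real (card A)" "real n / 2 \<le> real (card B)"
      using AB by (auto simp: large_disjoint_pairs_def)
    have "measure ?M {E. E \<inter> cross_edges A B = {}} = (1 - p) ^ (card A * card B)"
      using prob_erdos_renyi_avoids[OF p cross_edges_subset[OF *(1-3)]]
      by (simp add: card_cross_edges *)
    also have "\<dots> \<le> exp (- p) ^ (card A * card B)"
      using p exp_ge_add_one_self[of "- p"] by (intro power_mono) auto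
    also have "\<dots> = exp (- (p * (real (card A) * real (card B))))"
      by (simp add: exp_of_nat_mult[symmetric] mult_ac)
    also have "\<dots> \<le> exp (- (p * (\<gamma> * real n * (real n / 2))))"
      unfolding exp_le_cancel_iff neg_le_iff_le
      using p \<gamma> * by (intro mult_left_mono mult_mono) auto
    finally show ?thesis
      by (simp add: power2_eq_square mult_ac)
  qed
  have "measure ?M {E. \<exists>(A, B)\<in>?P. E \<inter> cross_edges A B = {}} =
      measure ?M (\<Union>(A, B)\<in>?P. {E. E \<inter> cross_edges A B = {}})"
    by (rule arg_cong[where f = "measure ?M"]) auto
  also have "\<dots> \<le> (\<Sum>(A, B)\<in>?P. measure ?M {E. E \<inter> cross_edges A B = {}})"
    using measure_UNION_le[OF fin, of "\<lambda>(A, B). {E. E \<inter> cross_edges A B = {}}" ?M]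
    by (simp add: case_prod_beta)
  also have "\<dots> \<le> (\<Sum>_\<in>?P. exp (- (p * \<gamma> * real n ^ 2 / 2)))"
    using single by (intro sum_mono) auto
  also have "\<dots> \<le> 4 ^ n * exp (- (p * \<gamma> * real n ^ 2 / 2))"
    using card by simp
  finally show ?thesis .
qed

text \<open>The exponent is \<open>n\<close> times \<open>K * n powr (1 - c)\<close>, and this last
  factor is unbounded because \<open>c < 1\<close>, so it eventually beats the
  \<open>n * ln 4\<close> coming from \<open>4 ^ n\<close>.\<close>

lemma union_bound_tendsto_0:
  fixes c K :: real
  assumes "c < 1" "K > 0"
  shows "(\<lambda>n. 4 ^ n * exp (- (K * real n powr (- c) * real n ^ 2))) \<longlonglongrightarrow> 0"
proof (rule tendsto_sandwich[of "\<lambda>_. 0" _ _ "\<lambda>n. exp (- real n)"])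
  have "filterlim (\<lambda>n. K * real n powr (1 - c)) at_top sequentially"
    using assms by real_asymp
  \<comment> \<open>The surplus 1 over \<open>ln 4\<close> is what leaves \<open>exp (- n)\<close>
    as majorant.\<close>
  then have "\<forall>\<^sub>F n in sequentially. ln 4 + 1 \<le> K * real n powr (1 - c)"
    by (simp add: filterlim_at_top)
  then show "\<forall>\<^sub>F n in sequentially.
      4 ^ n * exp (- (K * real n powr (- c) * real n ^ 2)) \<le> exp (- real n)"
    using eventually_gt_at_top[of 0]
  proof eventually_elim
    case (elim n)
    have "real n powr (- c) * real n ^ 2 = real n * real n powr (1 - c)"
      using elim by (simp add: powr_diff powr_minus field_simps power2_eq_square)
    then have eq: "K * real n powr (- c) * real n ^ 2 = real n * (K * real n powr (1 - c))"
      by (simp add: mult_ac)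
    have "(4::real) ^ n = exp (real n * ln 4)"
      by (simp add: exp_of_nat_mult)
    then have "4 ^ n * exp (- (K * real n powr (- c) * real n ^ 2)) =
        exp (real n * (ln 4 - K * real n powr (1 - c)))"
      unfolding eq by (simp add: exp_add[symmetric] algebra_simps)
    also have "\<dots> \<le> exp (real n * (- 1))"
      unfolding exp_le_cancel_iff using elim by (intro mult_left_mono) auto
    finally show ?case by simp
  qed
qed (auto, real_asymp)

theorem theorem7:
  fixes c :: real and p :: "nat \<Rightarrow> real"
  assumes "0 \<le> c" and "c < 1"
    and "\<And>n. n \<ge> 1 \<Longrightarrow> 0 \<le> p n \<and> p n \<le> 1"
    and "\<exists>k>0. \<exists>n0. \<forall>n\<ge>n0. p n \<ge> k * real n powr (- c)"
  shows "\<forall>\<epsilon>>0. \<forall>\<delta>>0. \<exists>N. \<forall>n\<ge>N.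
    measure_pmf.prob (erdos_renyi n (p n))
      {E. GAPVB {1..n} E < ereal (1 + \<delta>)} > 1 - \<epsilon>"
proof (intro allI impI)
  fix \<epsilon> \<delta> :: real
  assume \<epsilon>: "\<epsilon> > 0" and \<delta>: "\<delta> > 0"
  obtain k n0 where k: "k > 0" and p_ge: "\<And>n. n \<ge> n0 \<Longrightarrow> p n \<ge> k * real n powr (- c)"
    using assms(4) by blast
  define \<gamma> where "\<gamma> = \<delta> / (3 * (1 + \<delta>))"
  have \<gamma>: "\<gamma> > 0"
    using \<delta> by (simp add: \<gamma>_def)
  \<comment> \<open>The constant \<open>k * \<gamma> / 2\<close> results from putting the lower
    bound \<open>k * n powr (- c)\<close> for \<open>p n\<close> into the exponent of the union
    bound.\<close>
  have "\<forall>\<^sub>F n in sequentially. 4 ^ n * exp (- (k * \<gamma> / 2 * real n powr (- c) * real n ^ 2)) < \<epsilon>"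
    using union_bound_tendsto_0[OF assms(2), of "k * \<gamma> / 2"] k \<gamma> \<epsilon> by (intro order_tendstoD) auto
  then have "\<forall>\<^sub>F n in sequentially. measure_pmf.prob (erdos_renyi n (p n))
      {E. GAPVB {1..n} E < ereal (1 + \<delta>)} > 1 - \<epsilon>"
    \<comment> \<open>The threshold 3 serves \<open>GAPVB_less\<close> and also gives
      \<open>n \<ge> 1\<close>, so that \<open>p n\<close> is a probability.\<close>
    using eventually_ge_at_top[of n0] eventually_ge_at_top[of 3]
  proof eventually_elim
    case (elim n)
    let ?M = "measure_pmf (erdos_renyi n (p n))"
    let ?bad = "{E. \<exists>(A, B)\<in>large_disjoint_pairs \<gamma> n. E \<inter> cross_edges A B = {}}"
    have p: "0 \<le> p n" "p n \<le> 1"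
      using assms(3)[of n] elim by auto
    have "k * real n powr (- c) * (\<gamma> * real n ^ 2 / 2) \<le> p n * (\<gamma> * real n ^ 2 / 2)"
      using p_ge[of n] elim \<gamma> by (intro mult_right_mono) auto
    then have "4 ^ n * exp (- (p n * \<gamma> * real n ^ 2 / 2)) \<le>
        4 ^ n * exp (- (k * \<gamma> / 2 * real n powr (- c) * real n ^ 2))"
      by (simp add: mult_ac)
    then have bad: "measure ?M ?bad < \<epsilon>"
      using prob_nonadjacent_pair_le[OF p, of \<gamma> n] \<gamma> elim by linarith
    \<comment> \<open>Off the bad event every large disjoint pair is joined by an edge, which is the
      premise of \<open>GAPVB_less\<close>.\<close>
    have "- ?bad \<subseteq> {E. GAPVB {1..n} E < ereal (1 + \<delta>)}"
      using GAPVB_less[OF \<delta>, of n] elim by (auto simp: \<gamma>_def)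
    then have "measure ?M (- ?bad) \<le> measure ?M {E. GAPVB {1..n} E < ereal (1 + \<delta>)}"
      by (intro measure_pmf.finite_measure_mono) auto
    moreover have "measure ?M (- ?bad) = 1 - measure ?M ?bad"
      using measure_pmf.prob_compl[of ?bad "erdos_renyi n (p n)"] by (simp add: Compl_eq_Diff_UNIV)
    ultimately show ?case
      using bad by linarith
  qed
  then show "\<exists>N. \<forall>n\<ge>N. measure_pmf.prob (erdos_renyi n (p n))
      {E. GAPVB {1..n} E < ereal (1 + \<delta>)} > 1 - \<epsilon>"
    by (simp add: eventually_sequentially)
qed

end
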